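(* Let $A$ be a semisimple complex Banach algebra with identity such that $\mathrm{Soc}\,A$ is finite-dimensional. Then there exist an integer $k\ge 0$ and positive integers $n_1,\dots,n_k$ such that, as algebras, $$\mathrm{Soc}\,A\cong M_{n_1}(\mathbb{C})\oplus\cdots\oplus M_{n_k}(\mathbb{C}).$$
   Context: $\mathrm{Soc}\,A$ is the socle of $A$, the sum of all minimal left ideals of $A$ ($\{0\}$ if there are none). For semisimple $A$ it is a two-sided ideal and coincides with the set of finite-rank elements, i.e. those $a\in A$ with $\mathrm{rank}(a)=\sup_{x\in A}\#(\sigma(xa)\setminus\{0\})<\infty$, $\sigma$ denoting the spectrum. $\cong$ means algebra isomorphism; the direct sum has pointwise operations, and the empty direct sum ($k=0$) is the zero algebra, covering the case $\mathrm{Soc}\,A=\{0\}$. *)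

theory Defs
  imports Complex_Main "HOL-Library.FuncSet" "Jordan_Normal_Form.Matrix"
begin

text \<open>
  The norm is submultiplicative, but neither \<open>norm 1 = 1\<close> nor \<open>1 \<noteq> 0\<close> is required; in
  particular the zero algebra is an instance. The axiom \<open>scaleR_scaleC\<close> makes the underlying
  real structure the restriction of the complex one.
\<close>

class complex_banach_algebra_with_identity = real_normed_algebra + monoid_mult + banach +
  fixes scaleC :: "complex \<Rightarrow> 'a \<Rightarrow> 'a" (infixr "*\<^sub>C" 75)
  assumes scaleR_scaleC: "r *\<^sub>R x = complex_of_real r *\<^sub>C x"
    and scaleC_add_right: "c *\<^sub>C (x + y) = c *\<^sub>C x + c *\<^sub>C y"
    and scaleC_add_left: "(c + d) *\<^sub>C x = c *\<^sub>C x + d *\<^sub>C x"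
    and scaleC_scaleC: "c *\<^sub>C d *\<^sub>C x = (c * d) *\<^sub>C x"
    and mult_scaleC_left: "(c *\<^sub>C x) * y = c *\<^sub>C (x * y)"
    and mult_scaleC_right: "x * (c *\<^sub>C y) = c *\<^sub>C (x * y)"
    and norm_scaleC: "norm (c *\<^sub>C x) = cmod c * norm x"

interpretation complex_vector:
  vector_space "scaleC :: complex \<Rightarrow> 'a \<Rightarrow> 'a::complex_banach_algebra_with_identity"
proof
  fix x :: 'a
  have "1 *\<^sub>C x = 1 *\<^sub>R x"
    by (simp only: scaleR_scaleC of_real_1)
  then show "1 *\<^sub>C x = x" by simp
qed (simp_all add: scaleC_add_right scaleC_add_left scaleC_scaleC)

definition left_ideal :: "'a::complex_banach_algebra_with_identity set \<Rightarrow> bool" where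
  "left_ideal L \<longleftrightarrow> complex_vector.subspace L \<and> (\<forall>a. \<forall>x\<in>L. a * x \<in> L)"

definition minimal_left_ideal :: "'a::complex_banach_algebra_with_identity set \<Rightarrow> bool" where
  "minimal_left_ideal L \<longleftrightarrow> left_ideal L \<and> L \<noteq> {0} \<and>
     (\<forall>M. left_ideal M \<and> M \<subseteq> L \<longrightarrow> M = {0} \<or> M = L)"

definition maximal_left_ideal :: "'a::complex_banach_algebra_with_identity set \<Rightarrow> bool" where
  "maximal_left_ideal L \<longleftrightarrow> left_ideal L \<and> L \<noteq> UNIV \<and>
     (\<forall>M. left_ideal M \<and> L \<subseteq> M \<longrightarrow> M = L \<or> M = UNIV)"

definition jacobson_radical :: "'a::complex_banach_algebra_with_identity set" where
  "jacobson_radical = \<Inter>{L. maximal_left_ideal L}"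

definition semisimple :: "'a::complex_banach_algebra_with_identity itself \<Rightarrow> bool" where
  "semisimple _ \<longleftrightarrow> (jacobson_radical :: 'a set) = {0}"

text \<open>
  The (internal, not necessarily direct) sum of all minimal left ideals: finite sums of elements
  taken from minimal left ideals. With no minimal left ideal only the empty sum remains.
\<close>

definition socle :: "'a::complex_banach_algebra_with_identity set" where
  "socle = {(\<Sum>L\<in>F. f L) | F f.
     finite F \<and> (\<forall>L\<in>F. minimal_left_ideal L \<and> f L \<in> L)}"

definition finite_dimensional :: "'a::complex_banach_algebra_with_identity set \<Rightarrow> bool" where
  "finite_dimensional S \<longleftrightarrow> (\<exists>B. finite B \<and> complex_vector.span B = S)"

text \<open>
  Complex algebras given by a carrier and operations, with no unit in the signature since the
  socle comes without one. The field names carry a prefix to keep them apart from those of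
  HOL-Algebra. The record holds raw data; it is used only at the algebras defined below.
\<close>

record 'b calg =
  ca_carrier :: "'b set"
  ca_add :: "'b \<Rightarrow> 'b \<Rightarrow> 'b"
  ca_mult :: "'b \<Rightarrow> 'b \<Rightarrow> 'b"
  ca_scale :: "complex \<Rightarrow> 'b \<Rightarrow> 'b"

definition calg_iso :: "'b calg \<Rightarrow> 'c calg \<Rightarrow> bool" where
  "calg_iso S T \<longleftrightarrow> (\<exists>\<phi>. bij_betw \<phi> (ca_carrier S) (ca_carrier T) \<and>
     (\<forall>x\<in>ca_carrier S. \<forall>y\<in>ca_carrier S. \<phi> (ca_add S x y) = ca_add T (\<phi> x) (\<phi> y)) \<and>
     (\<forall>x\<in>ca_carrier S. \<forall>y\<in>ca_carrier S. \<phi> (ca_mult S x y) = ca_mult T (\<phi> x) (\<phi> y)) \<and>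
     (\<forall>c. \<forall>x\<in>ca_carrier S. \<phi> (ca_scale S c x) = ca_scale T c (\<phi> x)))"

definition socle_calg :: "'a::complex_banach_algebra_with_identity calg" where
  "socle_calg = \<lparr>ca_carrier = socle, ca_add = (+), ca_mult = (*), ca_scale = (*\<^sub>C)\<rparr>"

definition matrix_calg :: "nat \<Rightarrow> complex mat calg" where
  "matrix_calg n =
     \<lparr>ca_carrier = carrier_mat n n, ca_add = (+), ca_mult = (*), ca_scale = (\<cdot>\<^sub>m)\<rparr>"

text \<open>
  Elements are functions with value \<open>undefined\<close> outside \<open>I\<close>, so for empty \<open>I\<close> the carrier is a
  singleton.
\<close>

definition direct_sum_calg :: "'i set \<Rightarrow> ('i \<Rightarrow> 'b calg) \<Rightarrow> ('i \<Rightarrow> 'b) calg" where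
  "direct_sum_calg I S =
     \<lparr>ca_carrier = (\<Pi>\<^sub>E i\<in>I. ca_carrier (S i)),
      ca_add = (\<lambda>f g. \<lambda>i\<in>I. ca_add (S i) (f i) (g i)),
      ca_mult = (\<lambda>f g. \<lambda>i\<in>I. ca_mult (S i) (f i) (g i)),
      ca_scale = (\<lambda>c f. \<lambda>i\<in>I. ca_scale (S i) c (f i))\<rparr>"

end

(*
  Semisimplicity makes A semiprime: x A x = 0 implies x = 0. Hence every minimal left ideal is A e
  with e idempotent, and finite dimension forces e A e = C e. For such e the product
  pairs e A with A e nondegenerately into C e; dual bases x_a of A e and y_b of e A give matrix
  units x_a y_b spanning A e A. For a maximal family of such idempotents with e_i A e_j = 0 for
  distinct i and j, sending s to the matrices of the coefficients of y_a s x_b in C e_i is an algebra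
  homomorphism on A whose restriction to the socle is bijective.
*)
theory Submission
  imports Defs "HOL-Computational_Algebra.Fundamental_Theorem_Algebra"
begin

text \<open>The last condition says e A e = C e, an algebraic form of rank one that avoids spectra.
  The scalar is unique because \<open>e\<close> is nonzero.\<close>

definition rank_one_idempotent :: "'a::complex_banach_algebra_with_identity \<Rightarrow> bool" where
  "rank_one_idempotent e \<longleftrightarrow> e \<noteq> 0 \<and> e * e = e \<and> (\<forall>a. \<exists>c. e * a * e = c *\<^sub>C e)"

section \<open>Semiprimeness\<close>

text \<open>Closure under scalars comes from the identity of the algebra: a multiple of
  \<open>x\<close> is the product of \<open>c *\<^sub>C 1\<close> with \<open>x\<close>.\<close>

lemma left_idealI:
  assumes "0 \<in> L" "\<And>x y. x \<in> L \<Longrightarrow> y \<in> L \<Longrightarrow> x + y \<in> L" "\<And>a x. x \<in> L \<Longrightarrow> a * x \<in> L"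
  shows "left_ideal L"
proof -
  have "c *\<^sub>C x \<in> L" if "x \<in> L" for c x
    using assms(3)[OF that, of "c *\<^sub>C 1"] by (simp add: mult_scaleC_left)
  then show ?thesis
    using assms by (simp add: left_ideal_def complex_vector.subspace_def)
qed

lemma left_idealD:
  assumes "left_ideal L"
  shows "0 \<in> L" "x \<in> L \<Longrightarrow> y \<in> L \<Longrightarrow> x + y \<in> L" "x \<in> L \<Longrightarrow> a * x \<in> L"
    "x \<in> L \<Longrightarrow> y \<in> L \<Longrightarrow> x - y \<in> L"
  using assms by (auto simp: left_ideal_def complex_vector.subspace_0
      complex_vector.subspace_add complex_vector.subspace_diff)

lemma left_ideal_image_mult_right:
  assumes "left_ideal L"
  shows "left_ideal ((\<lambda>z. z * u) ` L)"
proof (rule left_idealI)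
  show "0 \<in> (\<lambda>z. z * u) ` L"
    using left_idealD(1)[OF assms] by (intro image_eqI[of _ _ 0]) auto
next
  fix x y assume "x \<in> (\<lambda>z. z * u) ` L" "y \<in> (\<lambda>z. z * u) ` L"
  then obtain p q where "p \<in> L" "q \<in> L" "x = p * u" "y = q * u" by auto
  then show "x + y \<in> (\<lambda>z. z * u) ` L"
    using left_idealD(2)[OF assms] by (intro image_eqI[of _ _ "p + q"]) (auto simp: distrib_right)
next
  fix a x assume "x \<in> (\<lambda>z. z * u) ` L"
  then obtain p where "p \<in> L" "x = p * u" by auto
  then show "a * x \<in> (\<lambda>z. z * u) ` L"
    using left_idealD(3)[OF assms] by (intro image_eqI[of _ _ "a * p"]) (auto simp: mult.assoc)
qed

lemma left_ideal_UNIV: "left_ideal UNIV"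
  by (rule left_idealI) auto

lemma left_ideal_principal: "left_ideal (range (\<lambda>a. a * u))"
  by (rule left_ideal_image_mult_right[OF left_ideal_UNIV])

lemma left_ideal_mult_right_vimage:
  assumes "left_ideal L" "left_ideal M"
  shows "left_ideal {z \<in> L. z * u \<in> M}"
  by (rule left_idealI)
    (use left_idealD[OF assms(1)] left_idealD[OF assms(2)] in \<open>auto simp: distrib_right mult.assoc\<close>)

lemma minimal_left_ideal_eq:
  assumes "minimal_left_ideal L" "left_ideal M" "M \<subseteq> L" "x \<in> M" "x \<noteq> 0"
  shows "M = L"
  using assms unfolding minimal_left_ideal_def by blast

text \<open>If x lay outside a maximal left ideal M, then M + A x = A would give 1 = m + a x with m
  in M. Since (a x)^2 = 0, the element 1 + a x is a left inverse of m, which forces M = A.\<close>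

lemma semisimple_imp_semiprime:
  fixes x :: "'a::complex_banach_algebra_with_identity"
  assumes ss: "semisimple TYPE('a)" and x: "\<And>a. x * a * x = 0"
  shows "x = 0"
proof -
  have "x \<in> M" if M: "maximal_left_ideal M" for M
  proof (rule ccontr)
    assume xM: "x \<notin> M"
    have li: "left_ideal M" and ne: "M \<noteq> UNIV"
      using M by (auto simp: maximal_left_ideal_def)
    note Mi = left_idealD[OF li]
    let ?N = "{m + a * x | m a. m \<in> M}"
    have "left_ideal ?N"
    proof (rule left_idealI)
      show "0 \<in> ?N" using Mi(1) by (auto intro!: exI[of _ 0])
    next
      fix p q assume "p \<in> ?N" "q \<in> ?N"
      then obtain m a n b where "m \<in> M" "n \<in> M" "p = m + a * x" "q = n + b * x" by auto
      then have "p + q = (m + n) + (a + b) * x" "m + n \<in> M"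
        using Mi(2) by (auto simp: algebra_simps)
      then show "p + q \<in> ?N" by blast
    next
      fix b p assume "p \<in> ?N"
      then obtain m a where "m \<in> M" "p = m + a * x" by auto
      then have "b * p = b * m + (b * a) * x" "b * m \<in> M"
        using Mi(3) by (auto simp: algebra_simps)
      then show "b * p \<in> ?N" by blast
    qed
    moreover have "M \<subseteq> ?N"
    proof
      fix m assume "m \<in> M"
      moreover have "m = m + 0 * x" by simp
      ultimately show "m \<in> ?N" by blast
    qed
    moreover have "x = 0 + 1 * x" by simp
    then have "x \<in> ?N" using Mi(1) by blast
    ultimately have "?N = UNIV"
      using M xM unfolding maximal_left_ideal_def by blast
    then obtain m a where m: "m \<in> M" "1 = m + a * x" by blast
    then have m_eq: "m = 1 - a * x" by (simp add: algebra_simps)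
    have "a * x * (a * x) = 0" using x[of a] by (simp add: mult.assoc)
    then have "(1 + a * x) * m = 1" by (simp add: m_eq algebra_simps)
    then have "1 \<in> M" using Mi(3)[OF m(1), of "1 + a * x"] by simp
    then have "b \<in> M" for b using Mi(3)[of 1 b] by simp
    then show False using ne by auto
  qed
  then have "x \<in> jacobson_radical" by (simp add: jacobson_radical_def)
  then show ?thesis using ss unfolding semisimple_def by blast
qed

text \<open>For z = f a e every product z b z contains the factor e b f = 0, so semiprimeness kills
  z. Orthogonality thus becomes symmetric, as enlarging a family of idempotents requires.\<close>

lemma semisimple_corner_zero_commute:
  fixes e f :: "'a::complex_banach_algebra_with_identity"
  assumes ss: "semisimple TYPE('a)" and ef: "\<And>a. e * a * f = 0"
  shows "f * a * e = 0"
proof (rule semisimple_imp_semiprime[OF ss])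
  fix b
  have "f * a * e * b * (f * a * e) = f * a * (e * b * f) * a * e" by (simp add: mult.assoc)
  then show "f * a * e * b * (f * a * e) = 0" by (simp add: ef)
qed

section \<open>Minimal left ideals and rank-one idempotents\<close>

text \<open>Brauer's argument: some u in L has L u nonzero, so L u = L by minimality and some e in L
  satisfies e u = u. Then e e - e lies in the left annihilator of u in L, which is a proper left
  subideal and hence zero.\<close>

lemma minimal_left_ideal_idempotent:
  fixes L :: "'a::complex_banach_algebra_with_identity set"
  assumes ss: "semisimple TYPE('a)" and L: "minimal_left_ideal L"
  obtains e where "e \<noteq> 0" "e * e = e" "L = range (\<lambda>a. a * e)"
proof -
  have li: "left_ideal L" using L by (simp add: minimal_left_ideal_def)
  note Li = left_idealD[OF li]
  obtain x where x: "x \<in> L" "x \<noteq> 0"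
    using L Li(1) unfolding minimal_left_ideal_def by blast
  obtain a where a: "x * a * x \<noteq> 0" using semisimple_imp_semiprime[OF ss] x(2) by blast
  define u where "u = a * x"
  have u: "u \<in> L" "x * u \<noteq> 0" using x a Li(3) by (auto simp: u_def mult.assoc)
  have "(\<lambda>z. z * u) ` L = L"
    by (rule minimal_left_ideal_eq[OF L left_ideal_image_mult_right[OF li] _ imageI[OF x(1)] u(2)])
      (use Li(3) u(1) in auto)
  then obtain e where e: "e \<in> L" "e * u = u" using u(1) by (metis imageE)
  let ?K = "{z \<in> L. z * u \<in> {0}}"
  have "left_ideal ({0} :: 'a set)" by (rule left_idealI) auto
  then have "left_ideal ?K" by (rule left_ideal_mult_right_vimage[OF li])
  moreover have "?K \<noteq> L" "?K \<subseteq> L" using x u by auto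
  ultimately have K: "?K = {0}" using L unfolding minimal_left_ideal_def by blast
  have "(e * e - e) * u = 0" using e by (simp add: left_diff_distrib mult.assoc)
  moreover have "e * e - e \<in> L" using Li e by blast
  ultimately have "e * e - e \<in> ?K" by simp
  then have "e * e - e = 0" unfolding K by simp
  then have ee: "e * e = e" by simp
  moreover have "e \<noteq> 0" using e u by auto
  moreover have "range (\<lambda>a. a * e) = L"
    by (rule minimal_left_ideal_eq[OF L left_ideal_principal _ rangeI[of _ 1]])
      (use \<open>e \<noteq> 0\<close> Li(3) e in auto)
  ultimately show ?thesis using that by metis
qed

lemma minimal_left_ideal_subset_socle:
  assumes "minimal_left_ideal L"
  shows "L \<subseteq> socle"
proof
  fix x assume "x \<in> L"
  then show "x \<in> socle"
    using assms unfolding socle_def by (auto intro!: exI[of _ "{L}"] exI[of _ "\<lambda>_. x"])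
qed

lemma zero_in_socle: "0 \<in> socle"
  unfolding socle_def by (auto intro!: exI[of _ "{}"])

text \<open>Right multiplication by u is a map of left modules, so L u is zero or again minimal: a
  left ideal inside L u has preimage zero or all of L.\<close>

lemma minimal_left_ideal_mult_right:
  assumes L: "minimal_left_ideal L" and "x \<in> L"
  shows "x * u \<in> socle"
proof (cases "\<forall>z\<in>L. z * u = 0")
  case True
  then show ?thesis using assms zero_in_socle by simp
next
  case False
  let ?Lu = "(\<lambda>z. z * u) ` L"
  have li: "left_ideal L" using L by (simp add: minimal_left_ideal_def)
  have "minimal_left_ideal ?Lu"
    unfolding minimal_left_ideal_def
  proof (intro conjI allI impI)
    show "left_ideal ?Lu" by (rule left_ideal_image_mult_right[OF li])
    show "?Lu \<noteq> {0}" using False by auto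
    fix M assume M: "left_ideal M \<and> M \<subseteq> ?Lu"
    let ?K = "{z \<in> L. z * u \<in> M}"
    have "left_ideal ?K" using left_ideal_mult_right_vimage li M by blast
    then have "?K = {0} \<or> ?K = L" using L unfolding minimal_left_ideal_def by blast
    then show "M = {0} \<or> M = ?Lu"
    proof
      assume K: "?K = {0}"
      have "m = 0" if m: "m \<in> M" for m
      proof -
        obtain z where "z \<in> L" "m = z * u" using M m by blast
        then have "z \<in> ?K" using m by simp
        then have "z = 0" unfolding K by simp
        then show ?thesis using \<open>m = z * u\<close> by simp
      qed
      then show ?thesis using M left_idealD(1)[of M] by auto
    next
      assume K: "?K = L"
      then show ?thesis using M by auto
    qed
  qed
  then show ?thesis using minimal_left_ideal_subset_socle assms(2) by blast
qed

text \<open>The value \<open>p(z) e\<close> when \<open>e * z = z = z * e\<close>, by Horner's scheme.\<close>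

definition corner_poly ::
    "'a::complex_banach_algebra_with_identity \<Rightarrow> 'a \<Rightarrow> complex poly \<Rightarrow> 'a" where
  "corner_poly z e p = fold_coeffs (\<lambda>a b. a *\<^sub>C e + z * b) p 0"

lemma corner_poly_0 [simp]: "corner_poly z e 0 = 0"
  by (simp add: corner_poly_def)

lemma corner_poly_pCons: "corner_poly z e (pCons a p) = a *\<^sub>C e + z * corner_poly z e p"
  by (cases "a = 0 \<and> p = 0") (auto simp: corner_poly_def)

text \<open>Otherwise the elements z^i e would be distinct and linearly independent, which is
  impossible for card B + 1 of them in the span of B.\<close>

lemma corner_poly_annihilator_exists:
  fixes z e :: "'a::complex_banach_algebra_with_identity"
  assumes B: "finite B" and span: "\<And>i. z ^ i * e \<in> complex_vector.span B"
  obtains p where "p \<noteq> 0" "corner_poly z e p = 0"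
proof -
  let ?ev = "corner_poly z e"
  have ev_add: "?ev (p + q) = ?ev p + ?ev q" for p q
    by (induction p q rule: poly_induct2)
      (auto simp: corner_poly_pCons scaleC_add_left algebra_simps)
  have ev_sum: "?ev (sum g I) = (\<Sum>i\<in>I. ?ev (g i))" for g and I :: "nat set"
    by (induction I rule: infinite_finite_induct) (auto simp: ev_add)
  have ev_monom: "?ev (monom c i) = c *\<^sub>C (z ^ i * e)" for c i
    by (induction i) (auto simp: corner_poly_pCons monom_0 monom_Suc mult_scaleC_right mult.assoc)
  show ?thesis
  proof (cases "\<exists>p. p \<noteq> 0 \<and> ?ev p = 0")
    case True
    then show ?thesis using that by blast
  next
    case False
    then have inj: "p = 0" if "?ev p = 0" for p using that by blast
    let ?m = "\<lambda>i. z ^ i * e"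
    \<comment> \<open>Independence concerns a set of vectors, so the powers must be distinct before
      they can be counted.\<close>
    have inj_m: "inj ?m"
    proof (rule injI)
      fix i j assume "?m i = ?m j"
      then have "?ev (monom 1 i + monom (-1) j) = 0" by (simp add: ev_add ev_monom)
      then have "monom 1 i + monom (-1) j = (0 :: complex poly)" by (rule inj)
      then have "coeff (monom 1 i + monom (-1) j) i = (0 :: complex)" by simp
      then show "i = j" by (auto split: if_splits)
    qed
    let ?A = "?m ` {..card B}"
    have "complex_vector.independent ?A"
    proof (rule complex_vector.independent_if_scalars_zero)
      fix f v assume sum0: "(\<Sum>v\<in>?A. f v *\<^sub>C v) = 0" and v: "v \<in> ?A"
      let ?p = "\<Sum>i\<le>card B. monom (f (?m i)) i"
      have "?ev ?p = (\<Sum>v\<in>?A. f v *\<^sub>C v)"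
        by (simp add: ev_sum ev_monom sum.reindex[OF inj_on_subset[OF inj_m subset_UNIV]])
      then have "?p = 0" using inj sum0 by simp
      obtain i where i: "i \<le> card B" "v = ?m i" using v by auto
      have "coeff ?p i = f (?m i)" using i(1) by (simp add: coeff_sum)
      then show "f v = 0" using \<open>?p = 0\<close> i by simp
    qed simp
    then have "card ?A \<le> card B"
      using complex_vector.independent_span_bound[OF B] span by blast
    then show ?thesis by (simp add: card_image[OF inj_on_subset[OF inj_m subset_UNIV]])
  qed
qed

text \<open>
  Here \<open>e A e\<close> is a finite-dimensional division algebra over the complex numbers: if \<open>z\<close> is no
  multiple of \<open>e\<close>, every factor \<open>z - c e\<close> of \<open>p(z)\<close> is left invertible, so \<open>p(z) \<noteq> 0\<close>.
\<close>

lemma minimal_left_ideal_rank_one: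
  fixes e :: "'a::complex_banach_algebra_with_identity"
  assumes fd: "finite_dimensional (socle :: 'a set)"
    and L: "minimal_left_ideal (range (\<lambda>a. a * e))" and e: "e \<noteq> 0" "e * e = e"
  shows "rank_one_idempotent e"
proof -
  obtain B where B: "finite B" "complex_vector.span B = (socle :: 'a set)"
    using fd unfolding finite_dimensional_def by blast
  have "\<exists>c. z = c *\<^sub>C e" if ez: "e * z = z" and ze: "z * e = z" for z
  proof (rule ccontr)
    assume no: "\<nexists>c. z = c *\<^sub>C e"
    let ?ev = "corner_poly z e"
    \<comment> \<open>All these elements lie in A e, hence in the finite-dimensional socle.\<close>
    have "z ^ i * e \<in> complex_vector.span B" for i
      using minimal_left_ideal_subset_socle[OF L] B by blast
    from corner_poly_annihilator_exists[OF B(1) this]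
    obtain p0 where p0: "p0 \<noteq> 0" "?ev p0 = 0" by blast
    have e_ev: "e * ?ev p = ?ev p" for p
      by (induction p)
        (auto simp: corner_poly_pCons distrib_left mult_scaleC_right e mult.assoc[symmetric] ez)
    have ev_linear_factor: "?ev (pCons 0 q - smult c q) = z * ?ev q - c *\<^sub>C ?ev q" for q c
    proof -
      have "?ev (r - smult c q) = ?ev r - c *\<^sub>C ?ev q" for r
        by (induction r q rule: poly_induct2)
          (auto simp: corner_poly_pCons right_diff_distrib mult_scaleC_right scaleC_scaleC
            scaleC_add_right complex_vector.scale_left_diff_distrib)
      then show ?thesis by (simp add: corner_poly_pCons)
    qed
    have "?ev p \<noteq> 0" if "p \<noteq> 0" for p
      using that
    proof (induction "degree p" arbitrary: p rule: less_induct)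
      case less
      show ?case
      proof (cases "degree p = 0")
        case True
        then obtain a where "p = [:a:]" by (rule degree_eq_zeroE)
        then show ?thesis using less.prems e by (simp add: corner_poly_pCons)
      next
        case False
        then obtain c where "poly p c = 0"
          using fundamental_theorem_of_algebra constant_degree by metis
        then obtain q where q: "p = [:-c, 1:] * q" by (auto simp: poly_eq_0_iff_dvd elim: dvdE)
        have "q \<noteq> 0" using less.prems q by auto
        then have "degree p = Suc (degree q)" unfolding q by (subst degree_mult_eq) auto
        then have evq: "?ev q \<noteq> 0" using less.hyps \<open>q \<noteq> 0\<close> by simp
        let ?w = "z - c *\<^sub>C e"
        have we: "?w = ?w * e" using e ze by (simp add: left_diff_distrib mult_scaleC_left)
        have "?w \<noteq> 0" using no by auto
        \<comment> \<open>The factor is nonzero and lies in A e, so by minimality it generates A e;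
          this supplies v below with v (z - c e) = e.\<close>
        have "range (\<lambda>a. a * ?w) = range (\<lambda>a. a * e)"
        proof (rule minimal_left_ideal_eq[OF L left_ideal_principal _ rangeI[of _ 1]])
          show "range (\<lambda>a. a * ?w) \<subseteq> range (\<lambda>a. a * e)"
          proof (rule image_subsetI)
            fix a
            have "a * ?w = (a * ?w) * e" by (subst we) (simp only: mult.assoc)
            then show "a * ?w \<in> range (\<lambda>a. a * e)" by blast
          qed
        qed (use \<open>?w \<noteq> 0\<close> in simp)
        then have "1 * e \<in> range (\<lambda>a. a * ?w)" by blast
        then obtain v where "1 * e = v * ?w" by (elim imageE)
        then have v: "v * ?w = e" by simp
        have "pCons 0 q - smult c q = p" unfolding q by simp
        then have "?ev p = z * ?ev q - c *\<^sub>C (e * ?ev q)"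
          using ev_linear_factor[of q c] by (simp add: e_ev)
        also have "\<dots> = ?w * ?ev q" by (simp add: left_diff_distrib mult_scaleC_left)
        \<comment> \<open>Cancelling the linear factor leaves e q(z) = q(z), which is nonzero by
          induction.\<close>
        finally have "v * ?ev p = (v * ?w) * ?ev q" by (simp only: mult.assoc)
        then have "v * ?ev p = e * ?ev q" by (simp only: v)
        then show ?thesis using evq by (auto simp: e_ev)
      qed
    qed
    then show False using p0 by blast
  qed
  moreover have "e * (e * a * e) = e * a * e" "e * a * e * e = e * a * e" for a
    by (simp_all only: mult.assoc e(2)) (simp only: mult.assoc[symmetric] e(2))
  ultimately show ?thesis using e by (simp add: rank_one_idempotent_def)
qed

lemma minimal_left_ideal_obtain_rank_one:
  fixes L :: "'a::complex_banach_algebra_with_identity set"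
  assumes "semisimple TYPE('a)" "finite_dimensional (socle :: 'a set)" "minimal_left_ideal L"
  obtains e where "rank_one_idempotent e" "L = range (\<lambda>a. a * e)"
  using minimal_left_ideal_idempotent[OF assms(1,3)] minimal_left_ideal_rank_one[OF assms(2)]
    assms(3) by metis

text \<open>Semiprimeness gives z a z nonzero, hence e a z = c e with c nonzero, and e a rescaled is
  the required y. So no nonzero z in A e is orthogonal to all of e A.\<close>

lemma rank_one_idempotent_left_inverse:
  fixes e :: "'a::complex_banach_algebra_with_identity"
  assumes ss: "semisimple TYPE('a)" and e: "rank_one_idempotent e" and z: "z * e = z" "z \<noteq> 0"
  obtains y where "e * y = y" "y * z = e"
proof -
  obtain a where a: "z * a * z \<noteq> 0" using semisimple_imp_semiprime[OF ss] z(2) by blast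
  obtain c where "e * (a * z) * e = c *\<^sub>C e" using e by (auto simp: rank_one_idempotent_def)
  then have c: "e * a * z = c *\<^sub>C e" by (simp add: mult.assoc z)
  have "z * a * z = z * (e * a * z)" using z(1) by (simp add: mult.assoc[symmetric])
  then have "c \<noteq> 0" using a c by auto
  then show ?thesis
    using that[of "inverse c *\<^sub>C (e * a)"] e c
    by (simp add: rank_one_idempotent_def mult_scaleC_left mult_scaleC_right mult.assoc[symmetric])
qed

text \<open>A nonzero z in a left subideal of A e admits y with y z = e, so the subideal contains
  e.\<close>

lemma rank_one_idempotent_minimal_left_ideal:
  fixes e :: "'a::complex_banach_algebra_with_identity"
  assumes ss: "semisimple TYPE('a)" and e: "rank_one_idempotent e"
  shows "minimal_left_ideal (range (\<lambda>a. a * e))"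
  unfolding minimal_left_ideal_def
proof (intro conjI allI impI)
  have ee: "e * e = e" "e \<noteq> 0" using e by (auto simp: rank_one_idempotent_def)
  then show "range (\<lambda>a. a * e) \<noteq> {0}" by (metis rangeI singletonD)
  fix M assume M: "left_ideal M \<and> M \<subseteq> range (\<lambda>a. a * e)"
  show "M = {0} \<or> M = range (\<lambda>a. a * e)"
  proof (cases "M \<subseteq> {0}")
    case True
    then show ?thesis using M left_idealD(1) by blast
  next
    case False
    then obtain z where z: "z \<in> M" "z \<noteq> 0" by blast
    moreover have "z * e = z" using M z ee by (auto simp: mult.assoc)
    ultimately obtain y where "y * z = e" using rank_one_idempotent_left_inverse[OF ss e] by metis
    then have "e \<in> M" using M z left_idealD(3) by metis
    then show ?thesis using M left_idealD(3) by blast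
  qed
qed (rule left_ideal_principal)

lemma rank_one_idempotent_mult_in_socle:
  fixes e :: "'a::complex_banach_algebra_with_identity"
  assumes "semisimple TYPE('a)" "rank_one_idempotent e"
  shows "a * e * b \<in> socle"
  using minimal_left_ideal_mult_right[OF rank_one_idempotent_minimal_left_ideal[OF assms]] by blast

section \<open>Dual bases and orthogonal families\<close>

text \<open>Multiplying a linear relation by \<open>y i\<close> from the left isolates the
  coefficient of \<open>x i\<close>. The value \<open>e i\<close> may vary with i so that the bound
  serves orthogonal families of idempotents as well as dual systems.\<close>

lemma biorthogonal_card_le:
  fixes x y e :: "'i \<Rightarrow> 'a::complex_banach_algebra_with_identity"
  assumes B: "finite B" "x ` I \<subseteq> complex_vector.span B" and I: "finite I"
    and e: "\<And>i. i \<in> I \<Longrightarrow> e i \<noteq> 0"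
    and yx: "\<And>i j. i \<in> I \<Longrightarrow> j \<in> I \<Longrightarrow> y i * x j = (if i = j then e i else 0)"
  shows "card I \<le> card B"
proof -
  have inj: "inj_on x I" by (rule inj_onI) (metis e yx)
  have "complex_vector.independent (x ` I)"
  proof (rule complex_vector.independent_if_scalars_zero)
    fix u v assume sum0: "(\<Sum>v\<in>x ` I. u v *\<^sub>C v) = 0" and "v \<in> x ` I"
    then obtain i where i: "i \<in> I" "v = x i" by auto
    have "0 = y i * (\<Sum>v\<in>x ` I. u v *\<^sub>C v)" using sum0 by simp
    also have "\<dots> = (\<Sum>j\<in>I. u (x j) *\<^sub>C (y i * x j))"
      by (simp add: sum.reindex[OF inj] sum_distrib_left mult_scaleC_right)
    also have "\<dots> = (\<Sum>j\<in>I. if i = j then u (x j) *\<^sub>C e i else 0)"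
      using i by (intro sum.cong) (auto simp: yx)
    also have "\<dots> = u v *\<^sub>C e i" using i I by simp
    finally show "u v = 0" using e i by auto
  qed (use I in simp)
  then have "card (x ` I) \<le> card B"
    using complex_vector.independent_span_bound[OF B(1)] B(2) by blast
  then show ?thesis by (simp add: card_image[OF inj])
qed

text \<open>The fixed-point equations encode that x_a lies in A e and y_a in e A; the rest is
  biorthogonality for the pairing (y, z) -> y z.\<close>

definition dual_system ::
    "'a::complex_banach_algebra_with_identity \<Rightarrow> nat \<Rightarrow> (nat \<Rightarrow> 'a) \<Rightarrow> (nat \<Rightarrow> 'a) \<Rightarrow> bool" where
  "dual_system e n x y \<longleftrightarrow> (\<forall>a<n. x a * e = x a \<and> e * y a = y a) \<and>
     (\<forall>a<n. \<forall>b<n. y a * x b = (if a = b then e else 0))"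

text \<open>A Gram-Schmidt step: the remainder of z is nonzero and killed by all y_b, so it has a
  partner w, which is then corrected to kill all x_b.\<close>

lemma dual_system_extend:
  fixes e :: "'a::complex_banach_algebra_with_identity"
  assumes ss: "semisimple TYPE('a)" and e: "rank_one_idempotent e" and d: "dual_system e n x y"
    and z: "z * e = z" "z \<noteq> (\<Sum>a<n. x a * (y a * z))"
  shows "\<exists>x y. dual_system e (Suc n) x y"
proof -
  have xe: "x a * e = x a" "e * y a = y a" if "a < n" for a
    using d that by (auto simp: dual_system_def)
  have yx: "y a * x b = (if a = b then e else 0)" if "a < n" "b < n" for a b
    using d that by (auto simp: dual_system_def)
  define z' where "z' = z - (\<Sum>a<n. x a * (y a * z))"
  have z'e: "z' * e = z'" by (simp add: z'_def left_diff_distrib sum_distrib_right mult.assoc z)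
  have yz': "y b * z' = 0" if "b < n" for b
  proof -
    have "y b * (\<Sum>a<n. x a * (y a * z)) = (\<Sum>a<n. (y b * x a) * (y a * z))"
      by (simp add: sum_distrib_left mult.assoc)
    also have "\<dots> = (\<Sum>a<n. if b = a then e * (y a * z) else 0)"
      using that by (intro sum.cong) (auto simp: yx)
    also have "\<dots> = y b * z" using that by (simp add: mult.assoc[symmetric] xe)
    finally show ?thesis by (simp add: z'_def right_diff_distrib)
  qed
  have "z' \<noteq> 0" using z(2) by (simp add: z'_def)
  then obtain w where w: "e * w = w" "w * z' = e"
    using rank_one_idempotent_left_inverse[OF ss e z'e] by metis
  \<comment> \<open>The correction leaves w z' = e intact, because every y_a kills z'.\<close>
  define w' where "w' = w - (\<Sum>a<n. w * x a * y a)"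
  have ew': "e * w' = w'"
    by (simp add: w'_def right_diff_distrib sum_distrib_left mult.assoc[symmetric] w)
  have w'x: "w' * x b = 0" if "b < n" for b
  proof -
    have "(\<Sum>a<n. w * x a * y a) * x b = (\<Sum>a<n. w * x a * (y a * x b))"
      by (simp add: sum_distrib_right mult.assoc)
    also have "\<dots> = (\<Sum>a<n. if a = b then w * x a * e else 0)"
      using that by (intro sum.cong) (auto simp: yx)
    also have "\<dots> = w * x b" using that by (simp add: mult.assoc xe)
    finally show ?thesis by (simp add: w'_def left_diff_distrib)
  qed
  have "w' * z' = e"
    by (simp add: w'_def left_diff_distrib w sum_distrib_right mult.assoc yz')
  then have "dual_system e (Suc n) (x(n := z')) (y(n := w'))"
    unfolding dual_system_def using xe yx z'e ew' yz' w'x by (auto simp: less_Suc_eq)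
  then show ?thesis by blast
qed

text \<open>Dual systems have bounded length, so a longest one exists, and it must expand all of A
  e. The expansion of e A then follows from semiprimeness.\<close>

lemma dual_basis_exists:
  fixes e :: "'a::complex_banach_algebra_with_identity"
  assumes ss: "semisimple TYPE('a)" and fd: "finite_dimensional (socle :: 'a set)"
    and e: "rank_one_idempotent e"
  obtains n x y where "n > 0" "dual_system e n x y"
    "\<And>z. z * e = z \<Longrightarrow> z = (\<Sum>a<n. x a * (y a * z))"
    "\<And>w. e * w = w \<Longrightarrow> w = (\<Sum>a<n. w * x a * y a)"
proof -
  obtain B where B: "finite B" "complex_vector.span B = (socle :: 'a set)"
    using fd unfolding finite_dimensional_def by blast
  have ee: "e \<noteq> 0" "e * e = e" using e by (auto simp: rank_one_idempotent_def)
  let ?P = "\<lambda>n. \<exists>x y. dual_system e n x y"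
  have bound: "n \<le> card B" if P: "?P n" for n
  proof -
    obtain x y where d: "dual_system e n x y" using P by blast
    have "x a \<in> socle" if "a < n" for a
      using d that rank_one_idempotent_mult_in_socle[OF ss e, of "x a" 1]
      by (simp add: dual_system_def)
    then have "card {..<n} \<le> card B"
      using d B ee by (intro biorthogonal_card_le[of B x _ "\<lambda>_. e" y]) (auto simp: dual_system_def)
    then show ?thesis by simp
  qed
  have "?P 0" by (simp add: dual_system_def)
  then obtain n where "?P n" and max: "\<And>m. ?P m \<Longrightarrow> m \<le> n"
    using ex_has_greatest_nat[of ?P 0 id "Suc (card B)"] bound by (auto simp: less_Suc_eq_le)
  then obtain x y where d: "dual_system e n x y" by blast
  have z: "z = (\<Sum>a<n. x a * (y a * z))" if "z * e = z" for z
    using dual_system_extend[OF ss e d that] max[of "Suc n"] by auto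
  have w: "w = (\<Sum>a<n. w * x a * y a)" if ew: "e * w = w" for w
  proof -
    define w' where "w' = w - (\<Sum>a<n. w * x a * y a)"
    have ew': "e * w' = w'"
      using d by (simp add: w'_def right_diff_distrib sum_distrib_left mult.assoc[symmetric] ew)
    \<comment> \<open>The remainder annihilates A e, and since w' = e w' this gives w' A w' =
      0.\<close>
    have w'z: "w' * z = 0" if "z * e = z" for z
    proof -
      have "(\<Sum>a<n. w * x a * y a) * z = w * (\<Sum>a<n. x a * (y a * z))"
        by (simp add: sum_distrib_left sum_distrib_right mult.assoc)
      also have "\<dots> = w * z" using z[OF that] by simp
      finally show ?thesis by (simp add: w'_def left_diff_distrib)
    qed
    have "w' * a * w' = 0" for a
    proof -
      have "w' * a * w' = w' * (a * e) * w'" using ew' by (simp add: mult.assoc)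
      then show ?thesis using w'z[of "a * e"] ee by (simp add: mult.assoc)
    qed
    then have "w' = 0" by (rule semisimple_imp_semiprime[OF ss])
    then show ?thesis by (simp add: w'_def)
  qed
  \<comment> \<open>With n = 0 the expansion of e would be an empty sum, contradicting that e is
    nonzero.\<close>
  have "n > 0" using z[of e] ee by (intro gr0I) auto
  then show ?thesis using that d z w by blast
qed

text \<open>A family of greatest cardinality cannot be enlarged by an idempotent orthogonal to it.
  In module terms, it picks one idempotent for each isomorphism class of minimal left
  ideals.\<close>

lemma orthogonal_family_exists:
  assumes ss: "semisimple TYPE('a::complex_banach_algebra_with_identity)"
    and fd: "finite_dimensional (socle :: 'a set)"
  obtains E :: "'a::complex_banach_algebra_with_identity set" where
    "finite E" "\<And>e. e \<in> E \<Longrightarrow> rank_one_idempotent e"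
    "\<And>e f a. e \<in> E \<Longrightarrow> f \<in> E \<Longrightarrow> e \<noteq> f \<Longrightarrow> e * a * f = 0"
    "\<And>f. rank_one_idempotent f \<Longrightarrow> \<exists>e\<in>E. \<exists>a. e * a * f \<noteq> 0"
proof -
  obtain B where B: "finite B" "complex_vector.span B = (socle :: 'a set)"
    using fd unfolding finite_dimensional_def by blast
  let ?O = "\<lambda>E :: 'a set. finite E \<and> (\<forall>e\<in>E. rank_one_idempotent e) \<and>
    (\<forall>e\<in>E. \<forall>f\<in>E. e \<noteq> f \<longrightarrow> (\<forall>a. e * a * f = 0))"
  have bound: "card E \<le> card B" if E: "?O E" for E
  proof (rule biorthogonal_card_le[of B id _ id id])
    show "id ` E \<subseteq> complex_vector.span B"
      using rank_one_idempotent_mult_in_socle[OF ss, of _ 1 1] E B by auto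
    fix e f assume "e \<in> E" "f \<in> E"
    then have "e * e = e" "e \<noteq> f \<Longrightarrow> e * 1 * f = 0"
      using E by (blast intro: rank_one_idempotent_def[THEN iffD1, THEN conjunct2, THEN conjunct1])+
    then show "id e * id f = (if e = f then id e else 0)" by auto
  qed (use E B in \<open>auto simp: rank_one_idempotent_def\<close>)
  obtain E where E: "?O E" and max: "\<And>F. ?O F \<Longrightarrow> card F \<le> card E"
    using ex_has_greatest_nat[of ?O "{}" card "Suc (card B)"] bound by (auto simp: less_Suc_eq_le)
  have "\<exists>e\<in>E. \<exists>a. e * a * f \<noteq> 0" if f: "rank_one_idempotent f" for f
  proof (rule ccontr)
    assume "\<not> ?thesis"
    then have ef: "e * a * f = 0" if "e \<in> E" for e a using that by blast
    then have fe: "f * a * e = 0" if "e \<in> E" for e a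
      using semisimple_corner_zero_commute[OF ss] that by blast
    \<comment> \<open>This keeps f out of E, so that inserting it really increases the
      cardinality.\<close>
    have "f * 1 * f \<noteq> 0" using f by (auto simp: rank_one_idempotent_def)
    then have "f \<notin> E" using ef by blast
    have "?O (insert f E)" using E f ef fe by auto
    from max[OF this] show False using E \<open>f \<notin> E\<close> by simp
  qed
  then show ?thesis using that[of E] E by blast
qed

section \<open>The isomorphism\<close>

text \<open>The junk value \<open>SOME c\<close> outside \<open>C e\<close> is irrelevant: the coordinate is only used on \<open>e A e\<close>.\<close>

definition corner_coord :: "'a::complex_banach_algebra_with_identity \<Rightarrow> 'a \<Rightarrow> complex" where
  "corner_coord e z = (SOME c. z = c *\<^sub>C e)"

lemma corner_coord_eqI:
  assumes "e \<noteq> 0" "z = c *\<^sub>C e"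
  shows "corner_coord e z = c"
  unfolding corner_coord_def using assms by (intro some_equality) auto

lemma corner_coord:
  assumes "rank_one_idempotent e" "e * z = z" "z * e = z"
  shows "z = corner_coord e z *\<^sub>C e"
proof -
  obtain c where "e * z * e = c *\<^sub>C e" using assms(1) by (auto simp: rank_one_idempotent_def)
  then have "\<exists>c. z = c *\<^sub>C e" using assms(2,3) by auto
  then show ?thesis unfolding corner_coord_def by (rule someI_ex)
qed

text \<open>
  If \<open>e A s A e = 0\<close> then \<open>s A e = 0\<close> by semiprimeness; as each minimal left ideal lies in
  \<open>A e A\<close> for some \<open>e\<close> in the family, \<open>s\<close> annihilates the socle and \<open>s A s = 0\<close>.
\<close>

lemma socle_eq_0I:
  fixes s :: "'a::complex_banach_algebra_with_identity"
  assumes ss: "semisimple TYPE('a)" and fd: "finite_dimensional (socle :: 'a set)"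
    and max: "\<And>f. rank_one_idempotent f \<Longrightarrow> \<exists>e\<in>E. \<exists>a. e * a * f \<noteq> 0"
    and s: "s \<in> socle" and zero: "\<And>e a b. e \<in> E \<Longrightarrow> e * a * s * b * e = 0"
  shows "s = 0"
proof -
  have sE: "s * b * e = 0" if "e \<in> E" for b e
  proof (rule semisimple_imp_semiprime[OF ss])
    fix a
    have "s * b * e * a * (s * b * e) = s * b * (e * a * s * b * e)" by (simp add: mult.assoc)
    then show "s * b * e * a * (s * b * e) = 0" using zero[OF that] by simp
  qed
  have sL: "s * z = 0" if L: "minimal_left_ideal L" and z: "z \<in> L" for z L
  proof -
    obtain f where f: "rank_one_idempotent f" and Lf: "L = range (\<lambda>a. a * f)"
      using minimal_left_ideal_obtain_rank_one[OF ss fd L] .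
    obtain b where zb: "z = b * f" using z Lf by auto
    obtain e a where e: "e \<in> E" "e * a * f \<noteq> 0" using max[OF f] by blast
    have "e * a * f * f = e * a * f" using f by (simp add: rank_one_idempotent_def mult.assoc)
    \<comment> \<open>Thus f = y e a f factors through e, and s annihilates everything of the form b
      e.\<close>
    then obtain y where y: "y * (e * a * f) = f"
      using rank_one_idempotent_left_inverse[OF ss f _ e(2)] by metis
    have "s * z = s * (b * y) * e * (a * f)"
      unfolding zb by (subst y[symmetric]) (simp add: mult.assoc)
    then show ?thesis by (simp add: sE[OF e(1)])
  qed
  have "s * a * s = 0" for a
  proof -
    obtain F g where F: "\<forall>L\<in>F. minimal_left_ideal L \<and> g L \<in> L" and sF: "s = (\<Sum>L\<in>F. g L)"
      using s unfolding socle_def by blast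
    \<comment> \<open>Only the right-hand s is expanded; each a g(L) stays in the left ideal L,
      which s annihilates.\<close>
    have "s * a * s = (\<Sum>L\<in>F. s * (a * g L))"
      by (subst (2) sF) (simp add: sum_distrib_left mult.assoc)
    also have "\<dots> = 0"
    proof (rule sum.neutral, rule ballI)
      fix L assume "L \<in> F"
      then have L: "minimal_left_ideal L" "g L \<in> L" using F by auto
      then have "a * g L \<in> L" by (simp add: minimal_left_ideal_def left_idealD(3))
      then show "s * (a * g L) = 0" using sL[OF L(1)] by blast
    qed
    finally show ?thesis .
  qed
  then show ?thesis by (rule semisimple_imp_semiprime[OF ss])
qed

theorem theorem3p9:
  assumes "semisimple TYPE('a::complex_banach_algebra_with_identity)"
    and "finite_dimensional (socle :: 'a set)"
  shows "\<exists>(k::nat) (n :: nat \<Rightarrow> nat). (\<forall>i\<in>{1..k}. n i > 0) \<and>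
    calg_iso (socle_calg :: 'a calg) (direct_sum_calg {1..k} (\<lambda>i. matrix_calg (n i)))"
proof -
  note ss = assms(1) and fd = assms(2)
  obtain B where B: "finite B" "complex_vector.span B = (socle :: 'a set)"
    using fd unfolding finite_dimensional_def by blast
  have sub: "complex_vector.subspace (socle :: 'a set)"
    by (metis B(2) complex_vector.subspace_span)
  obtain E :: "'a set" where E: "finite E" "\<And>e. e \<in> E \<Longrightarrow> rank_one_idempotent e"
    "\<And>e f a. e \<in> E \<Longrightarrow> f \<in> E \<Longrightarrow> e \<noteq> f \<Longrightarrow> e * a * f = 0"
    "\<And>f. rank_one_idempotent f \<Longrightarrow> \<exists>e\<in>E. \<exists>a. e * a * f \<noteq> 0"
    using orthogonal_family_exists[OF ss fd] by metis
  \<comment> \<open>One matrix block per idempotent; an empty family gives the empty direct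
    sum.\<close>
  define k where "k = card E"
  obtain e where e: "bij_betw e {1..k} E"
    using ex_bij_betw_nat_finite_1[OF E(1)] unfolding k_def by blast
  let ?I = "{1..k}"
  have eE: "e i \<in> E" if "i \<in> ?I" for i using e that by (auto simp: bij_betw_def)
  have eR: "rank_one_idempotent (e i)" if "i \<in> ?I" for i using E(2) eE that by blast
  have e0: "e i \<noteq> 0" and ee: "e i * e i = e i" if "i \<in> ?I" for i
    using eR[OF that] by (auto simp: rank_one_idempotent_def)
  have orth: "e i * a * e j = 0" if "i \<in> ?I" "j \<in> ?I" "i \<noteq> j" for i j a
  proof -
    have "e i \<noteq> e j" using e that by (auto simp: bij_betw_def dest: inj_onD)
    then show ?thesis using E(3) eE that by blast
  qed
  \<comment> \<open>Bundling the properties lets one choice step produce the sizes and both bases as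
    functions of i.\<close>
  define P where "P i n x y \<longleftrightarrow> n > 0 \<and> dual_system (e i) n x y \<and>
      (\<forall>z. z * e i = z \<longrightarrow> z = (\<Sum>a<n. x a * (y a * z))) \<and>
      (\<forall>w. e i * w = w \<longrightarrow> w = (\<Sum>a<n. w * x a * y a))" for i n x y
  have "\<exists>n x y. P i n x y" if "i \<in> ?I" for i
    unfolding P_def by (rule dual_basis_exists[OF ss fd eR[OF that]]) blast
  then obtain n x y where P: "\<And>i. i \<in> ?I \<Longrightarrow> P i (n i) (x i) (y i)" by metis
  have n: "n i > 0" and d: "dual_system (e i) (n i) (x i) (y i)" if "i \<in> ?I" for i
    using P[OF that] by (auto simp: P_def)
  have xb: "z = (\<Sum>a<n i. x i a * (y i a * z))" if "i \<in> ?I" "z * e i = z" for i z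
    using P[OF that(1)] that(2) unfolding P_def by blast
  have yb: "w = (\<Sum>a<n i. w * x i a * y i a)" if "i \<in> ?I" "e i * w = w" for i w
    using P[OF that(1)] that(2) unfolding P_def by blast
  have xe: "x i a * e i = x i a" and ey: "e i * y i a = y i a" if "i \<in> ?I" "a < n i" for i a
    using d[OF that(1)] that(2) by (auto simp: dual_system_def)
  have yx: "y i a * x i b = (if a = b then e i else 0)" if "i \<in> ?I" "a < n i" "b < n i" for i a b
    using d[OF that(1)] that(2,3) by (auto simp: dual_system_def)
  have yx0: "y i a * x j b = 0" if "i \<in> ?I" "j \<in> ?I" "i \<noteq> j" "a < n i" "b < n j" for i j a b
  proof -
    have "y i a * x j b = (e i * y i a) * (x j b * e j)" using that by (simp only: xe ey)
    also have "\<dots> = e i * (y i a * x j b) * e j" by (simp only: mult.assoc)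
    finally show ?thesis using orth that by simp
  qed
  \<comment> \<open>This is the (a, b) entry of left multiplication by s on A e_i in the basis x_i,
    since s x_b is the sum of the x_a (y_a s x_b).\<close>
  define co where "co i s a b = corner_coord (e i) (y i a * s * x i b)" for i s a b
  have co: "y i a * s * x i b = co i s a b *\<^sub>C e i" if "i \<in> ?I" "a < n i" "b < n i" for i s a b
    unfolding co_def
  proof (rule corner_coord[OF eR[OF that(1)]])
    show "e i * (y i a * s * x i b) = y i a * s * x i b"
      using ey[OF that(1,2)] by (simp add: mult.assoc[symmetric])
    show "y i a * s * x i b * e i = y i a * s * x i b"
      using xe[OF that(1,3)] by (simp add: mult.assoc)
  qed
  have coI: "co i s a b = c" if "i \<in> ?I" "y i a * s * x i b = c *\<^sub>C e i" for i s a b c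
    unfolding co_def using corner_coord_eqI e0 that by blast
  \<comment> \<open>The map is defined on all of A; restriction to the index set gives the value
    \<open>undefined\<close> elsewhere, as the carrier demands.\<close>
  define \<phi> where "\<phi> s = (\<lambda>i\<in>?I. mat (n i) (n i) (\<lambda>(a, b). co i s a b))" for s
  \<comment> \<open>The products x_a y_b act as matrix units, so this is the candidate
    inverse.\<close>
  define \<psi> where "\<psi> M = (\<Sum>i\<in>?I. \<Sum>a<n i. \<Sum>b<n i. (M i $$ (a, b)) *\<^sub>C (x i a * y i b))"
    for M :: "nat \<Rightarrow> complex mat"
  let ?T = "direct_sum_calg ?I (\<lambda>i. matrix_calg (n i))"
  have carT: "ca_carrier ?T = (\<Pi>\<^sub>E i\<in>?I. carrier_mat (n i) (n i))"
    by (simp add: direct_sum_calg_def matrix_calg_def)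
  have \<phi>_car: "\<phi> s \<in> ca_carrier ?T" for s
    unfolding carT by (auto simp: \<phi>_def)
  have \<psi>_socle: "\<psi> M \<in> socle" for M
    unfolding \<psi>_def
  proof (intro complex_vector.subspace_sum[OF sub] complex_vector.subspace_scale[OF sub])
    fix i a b assume "i \<in> ?I" "a \<in> {..<n i}" "b \<in> {..<n i}"
    then show "x i a * y i b \<in> socle"
      using rank_one_idempotent_mult_in_socle[OF ss eR, of i "x i a" "y i b"] by (simp add: xe)
  qed
  have co_\<psi>: "co i (\<psi> M) a b = M i $$ (a, b)"
    if i: "i \<in> ?I" and a: "a < n i" and b: "b < n i" for i M a b
  proof (rule coI[OF i])
    have units: "y i a * (x j c * y j d) * x i b =
        (if j = i \<and> c = a \<and> d = b then e i else 0)" if "j \<in> ?I" "c < n j" "d < n j" for j c d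
    proof -
      have "y i a * (x j c * y j d) * x i b = (y i a * x j c) * (y j d * x i b)"
        by (simp only: mult.assoc)
      then show ?thesis using i a b that by (cases "j = i") (auto simp: yx yx0 ee)
    qed
    have "y i a * \<psi> M * x i b =
        (\<Sum>j\<in>?I. \<Sum>c<n j. \<Sum>d<n j. (M j $$ (c, d)) *\<^sub>C (y i a * (x j c * y j d) * x i b))"
      by (simp add: \<psi>_def sum_distrib_left sum_distrib_right mult_scaleC_left mult_scaleC_right)
    also have "\<dots> = (\<Sum>j\<in>?I. \<Sum>c<n j. \<Sum>d<n j.
        if d = b then if c = a then if j = i then (M j $$ (c, d)) *\<^sub>C e i else 0 else 0 else 0)"
      by (intro sum.cong refl) (auto simp: units)
    \<comment> \<open>The test on j moves outside the inner sums, whose ranges depend on j; the sums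
      then collapse one by one.\<close>
    also have "\<dots> = (\<Sum>j\<in>?I. if j = i then \<Sum>c<n j. \<Sum>d<n j.
        if d = b then if c = a then (M j $$ (c, d)) *\<^sub>C e i else 0 else 0 else 0)"
      by (intro sum.cong refl) (simp cong: if_cong)
    also have "\<dots> = (M i $$ (a, b)) *\<^sub>C e i" using i a b by simp
    finally show "y i a * \<psi> M * x i b = (M i $$ (a, b)) *\<^sub>C e i" .
  qed
  have inj: "inj_on \<phi> socle"
  proof (rule inj_onI)
    fix s t :: 'a assume st: "s \<in> socle" "t \<in> socle" "\<phi> s = \<phi> t"
    have "s - t = 0"
    proof (rule socle_eq_0I[OF ss fd E(4)])
      show "s - t \<in> socle" using complex_vector.subspace_diff[OF sub] st by blast
      fix f a b assume "f \<in> E"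
      then obtain i where i: "i \<in> ?I" "f = e i" using e by (auto simp: bij_betw_def)
      have co_eq: "co i s c d = co i t c d" if "c < n i" "d < n i" for c d
      proof -
        have "\<phi> s i $$ (c, d) = \<phi> t i $$ (c, d)" using st by simp
        then show ?thesis using i that by (simp add: \<phi>_def)
      qed
      have zero: "y i c * (s - t) * x i d = 0" if "c < n i" "d < n i" for c d
        using co[OF i(1) that] co_eq[OF that] by (simp add: left_diff_distrib right_diff_distrib)
      \<comment> \<open>Expanding p in e A and q in A e by the dual bases writes p (s - t) q through
        the vanishing elements y_c (s - t) x_d.\<close>
      let ?p = "e i * a" and ?q = "b * e i"
      have p: "?p = (\<Sum>c<n i. ?p * x i c * y i c)"
        by (rule yb[OF i(1)]) (simp add: mult.assoc[symmetric] ee[OF i(1)])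
      have q: "?q = (\<Sum>d<n i. x i d * (y i d * ?q))"
        by (rule xb[OF i(1)]) (simp add: mult.assoc ee[OF i(1)])
      have "f * a * (s - t) * b * f = ?p * (s - t) * ?q" by (simp add: i mult.assoc)
      also have "\<dots> = (\<Sum>c<n i. \<Sum>d<n i. ?p * x i c * (y i c * (s - t) * x i d) * (y i d * ?q))"
        by (subst p, subst q)
            (simp only: sum_distrib_left sum_distrib_right mult.assoc, rule sum.swap)
      also have "\<dots> = 0" by (intro sum.neutral ballI) (simp add: zero)
      finally show "f * a * (s - t) * b * f = 0" .
    qed
    then show "s = t" by simp
  qed
  have "\<phi> ` socle = ca_carrier ?T"
  proof
    show "ca_carrier ?T \<subseteq> \<phi> ` socle"
    proof
      fix M assume "M \<in> ca_carrier ?T"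
      then have M: "M \<in> (\<Pi>\<^sub>E i\<in>?I. carrier_mat (n i) (n i))" unfolding carT .
      have "\<phi> (\<psi> M) = M"
      proof (rule PiE_ext[OF _ M])
        show "\<phi> (\<psi> M) \<in> (\<Pi>\<^sub>E i\<in>?I. carrier_mat (n i) (n i))" using \<phi>_car carT by simp
        fix i assume i: "i \<in> ?I"
        then have "M i \<in> carrier_mat (n i) (n i)" using M by blast
        then show "\<phi> (\<psi> M) i = M i" using i by (auto simp: \<phi>_def co_\<psi>)
      qed
      then show "M \<in> \<phi> ` socle" using \<psi>_socle by (metis imageI)
    qed
  qed (use \<phi>_car in auto)
  with inj have bij: "bij_betw \<phi> socle (ca_carrier ?T)" by (simp add: bij_betw_def)
  \<comment> \<open>The three compatibility laws hold on all of A; only bijectivity refers to the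
    socle.\<close>
  have add: "\<phi> (s + t) = ca_add ?T (\<phi> s) (\<phi> t)" for s t
  proof -
    have "co i (s + t) a b = co i s a b + co i t a b" if "i \<in> ?I" "a < n i" "b < n i" for i a b
      by (rule coI[OF that(1)]) (simp add: distrib_left distrib_right co[OF that] scaleC_add_left)
    then show ?thesis
      by (auto simp: \<phi>_def direct_sum_calg_def matrix_calg_def intro!: restrict_ext eq_matI)
  qed
  have scale: "\<phi> (c *\<^sub>C s) = ca_scale ?T c (\<phi> s)" for c s
  proof -
    have "co i (c *\<^sub>C s) a b = c * co i s a b" if "i \<in> ?I" "a < n i" "b < n i" for i a b
      by (rule coI[OF that(1)]) (simp add: mult_scaleC_left mult_scaleC_right co[OF that] scaleC_scaleC)
    then show ?thesis
      by (auto simp: \<phi>_def direct_sum_calg_def matrix_calg_def intro!: restrict_ext eq_matI)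
  qed
  have mult: "\<phi> (s * t) = ca_mult ?T (\<phi> s) (\<phi> t)" for s t
  proof -
    have "co i (s * t) a b = (\<Sum>c<n i. co i s a c * co i t c b)"
      if i: "i \<in> ?I" and a: "a < n i" and b: "b < n i" for i a b
    proof (rule coI[OF i])
      \<comment> \<open>Expanding y_a s in the basis y inserts the sum of the x_c y_c between s and
        t, which produces the matrix product.\<close>
      have expand: "y i a * s = (\<Sum>c<n i. y i a * s * x i c * y i c)"
        by (rule yb[OF i]) (simp add: mult.assoc[symmetric] ey[OF i a])
      have "y i a * (s * t) * x i b = y i a * s * t * x i b" by (simp only: mult.assoc)
      also have "\<dots> = (\<Sum>c<n i. y i a * s * x i c * y i c) * t * x i b"
        \<comment> \<open>The left side of \<open>expand\<close> recurs on its right side, so it is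
          applied once by congruence and not as a rewrite rule.\<close>
        by (rule arg_cong[OF expand])
      also have "\<dots> = (\<Sum>c<n i. (y i a * s * x i c) * (y i c * t * x i b))"
        by (simp only: sum_distrib_right mult.assoc)
      also have "\<dots> = (\<Sum>c<n i. (co i s a c * co i t c b) *\<^sub>C e i)"
        by (intro sum.cong refl)
          (use i a b in \<open>simp add: co[OF i] mult_scaleC_left mult_scaleC_right scaleC_scaleC ee[OF i]\<close>)
      finally show "y i a * (s * t) * x i b = (\<Sum>c<n i. co i s a c * co i t c b) *\<^sub>C e i"
        by (simp add: complex_vector.scale_sum_left)
    qed
    then show ?thesis
      by (auto simp: \<phi>_def direct_sum_calg_def matrix_calg_def scalar_prod_def atLeast0LessThan
          intro!: restrict_ext eq_matI)
  qed
  have "calg_iso (socle_calg :: 'a calg) ?T"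
    unfolding calg_iso_def socle_calg_def using bij add mult scale by (intro exI[of _ \<phi>]) simp
  then show ?thesis using n by blast
qed

end
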